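(* The map $\Phi\colon\mathcal{P}^+/\mathrm{SL}_2(\mathbb{Z})\longrightarrow \mathbf{FR}_\infty^+$, which sends the $\mathrm{SL}_2(\mathbb{Z})$-orbit of a clockwise bi-infinite path $\gamma$ to $\pm\mathbf{M}$, where $m_{i,j}=a_jb_i-b_ja_i$ and $a_i/b_i$ are the suitably normalised vertices of $\gamma$, is a one-to-one correspondence (a bijection).
   Context: An $\mathrm{SL}_2$-tiling is a function $\mathbf{M}\colon\mathbb{Z}\times\mathbb{Z}\to\mathbb{Z}$, with $m_{i,j}=\mathbf{M}(i,j)$, such that $m_{i,j}m_{i+1,j+1}-m_{i,j+1}m_{i+1,j}=1$ for all $i,j\in\mathbb{Z}$. It is tame if every $3\times 3$ submatrix of consecutive rows and columns has determinant $0$. An infinite frieze is an $\mathrm{SL}_2$-tiling $\mathbf{M}$ with $m_{j,i}=-m_{i,j}$ for all $i,j\in\mathbb{Z}$; it is a positive infinite frieze if moreover $m_{i,j}>0$ whenever $i>j$ (all positive infinite friezes are tame). $\mathbf{FR}_\infty$ is the set of tame infinite friezes with $\mathbf{M}$ and $-\mathbf{M}$ identified, and $\mathbf{FR}_\infty^+$ is the set of positive infinite friezes, regarded as a subset of $\mathbf{FR}_\infty$ via $\mathbf{M}\mapsto\pm\mathbf{M}$. A reduced rational is an expression $a/b$ with $a,b$ coprime integers, where $1/0$ and $(-1)/0$ are allowed and both represent $\infty$. The Farey graph $\mathcal{F}$ has vertex set $\mathbb{Q}_\infty=\mathbb{Q}\cup\{\infty\}$, with reduced rationals $a/b$ and $c/d$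 adjacent if and only if $ad-bc=\pm1$. A bi-infinite path in $\mathcal{F}$ is a sequence $\langle\dots,v_{-1},v_0,v_1,v_2,\dots\rangle$ of vertices indexed by $\mathbb{Z}$ with $v_i$ adjacent to $v_{i+1}$ for all $i$. $\mathrm{SL}_2(\mathbb{Z})$ acts on $\mathbb{Q}_\infty$ by Möbius transformations $z\mapsto\frac{az+b}{cz+d}$, preserving adjacency, hence acts vertexwise on bi-infinite paths. Identify $\mathbb{R}_\infty=\mathbb{R}\cup\{\infty\}$ with the unit circle by $z\mapsto(iz+1)/(z+i)$ (so $\infty\mapsto i$, $1\mapsto1$, $0\mapsto-i$, $-1\mapsto-1$; decreasing along $\mathbb{R}$ is clockwise). A bi-infinite path is clockwise if its vertices $v_i$ ($i\in\mathbb{Z}$) are distinct and, for all $i<j<k$, the images of $v_i,v_j,v_k$ are in clockwise order around the unit circle. $\mathcal{P}^+$ is the set of clockwise bi-infinite paths (it is invariant under $\mathrm{SL}_2(\mathbb{Z})$). Given a bi-infinite path $\gamma$, write its vertices as reduced rationals $v_i=a_i/b_i$ with $a_ib_{i+1}-a_{i+1}b_i=1$ for all $i\in\mathbb{Z}$ (possible in exactly two ways, differing by a global sign), and put $m_{i,j}=a_jb_i-b_ja_i$. The resulting $\pm\mathbf{M}$ lies in $\mathbf{FR}_\infty$ and depends only on the $\mathrm{SL}_2(\mathbb{Z})$-orbit of $\gamma$; this is $\Phi$ of that orbit. *)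

theory Defs
  imports Complex_Main "HOL-Analysis.Determinants"
begin

section \<open>Infinite friezes\<close>

type_synonym tiling = "int \<Rightarrow> int \<Rightarrow> int"

definition sl2_tiling :: "tiling \<Rightarrow> bool" where
  "sl2_tiling M \<longleftrightarrow>
     (\<forall>i j. M i j * M (i + 1) (j + 1) - M i (j + 1) * M (i + 1) j = 1)"

definition tame :: "tiling \<Rightarrow> bool" where
  "tame M \<longleftrightarrow> (\<forall>i j.
     det (vector [vector [M i j, M i (j + 1), M i (j + 2)],
                  vector [M (i + 1) j, M (i + 1) (j + 1), M (i + 1) (j + 2)],
                  vector [M (i + 2) j, M (i + 2) (j + 1), M (i + 2) (j + 2)]]
          :: int^3^3) = 0)"

definition infinite_frieze :: "tiling \<Rightarrow> bool" where
  "infinite_frieze M \<longleftrightarrow> sl2_tiling M \<and> (\<forall>i j. M j i = - M i j)"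

definition positive_infinite_frieze :: "tiling \<Rightarrow> bool" where
  "positive_infinite_frieze M \<longleftrightarrow> infinite_frieze M \<and> (\<forall>i j. i > j \<longrightarrow> M i j > 0)"

definition pm :: "tiling \<Rightarrow> tiling set" where
  "pm M = {M, (\<lambda>i j. - M i j)}"

definition FR_infty :: "tiling set set" where
  "FR_infty = pm ` {M. infinite_frieze M \<and> tame M}"

definition FR_infty_pos :: "tiling set set" where
  "FR_infty_pos = pm ` {M. positive_infinite_frieze M}"

text \<open>Tameness is not part of the definition of a positive infinite frieze; it is
  automatic, by Dodgson condensation off the diagonal and skew-symmetry on it.\<close>

lemma positive_infinite_frieze_tame:
  assumes "positive_infinite_frieze M"
  shows "tame M"
  unfolding tame_def
proof (intro allI)
  fix i j :: int
  let ?A = "vector [vector [M i j, M i (j + 1), M i (j + 2)],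
                  vector [M (i + 1) j, M (i + 1) (j + 1), M (i + 1) (j + 2)],
                  vector [M (i + 2) j, M (i + 2) (j + 1), M (i + 2) (j + 2)]] :: int^3^3"
  have t: "M k l * M (k + 1) (l + 1) - M k (l + 1) * M (k + 1) l = 1" for k l
    using assms unfolding positive_infinite_frieze_def infinite_frieze_def sl2_tiling_def
    by blast
  have skew: "M l k = - M k l" for k l
    using assms unfolding positive_infinite_frieze_def infinite_frieze_def by blast
  have pos: "M k l > 0" if "k > l" for k l
    using assms that by (simp add: positive_infinite_frieze_def)
  have D: "det ?A =
     M i j * M (i + 1) (j + 1) * M (i + 2) (j + 2)
     + M i (j + 1) * M (i + 1) (j + 2) * M (i + 2) j
     + M i (j + 2) * M (i + 1) j * M (i + 2) (j + 1)
     - M i j * M (i + 1) (j + 2) * M (i + 2) (j + 1)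
     - M i (j + 1) * M (i + 1) j * M (i + 2) (j + 2)
     - M i (j + 2) * M (i + 1) (j + 1) * M (i + 2) j"
    by (simp only: det_3 vector_3)
  show "det ?A = 0"
  proof (cases "i = j")
    case True
    have z: "M k k = 0" for k using skew[of k k] by linarith
    show ?thesis
      unfolding True skew[of "j + 1" j] skew[of "j + 2" j] skew[of "j + 2" "j + 1"] z
      by (simp add: det_3)
  next
    case False
    have nz: "M (i + 1) (j + 1) \<noteq> 0"
      using False pos[of "j + 1" "i + 1"] pos[of "i + 1" "j + 1"] skew[of "i + 1" "j + 1"]
      by linarith
    have t1: "M i j * M (i + 1) (j + 1) - M i (j + 1) * M (i + 1) j = 1"
      and t2: "M i (j + 1) * M (i + 1) (j + 2) - M i (j + 2) * M (i + 1) (j + 1) = 1"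
      and t3: "M (i + 1) j * M (i + 2) (j + 1) - M (i + 1) (j + 1) * M (i + 2) j = 1"
      and t4: "M (i + 1) (j + 1) * M (i + 2) (j + 2) - M (i + 1) (j + 2) * M (i + 2) (j + 1) = 1"
      using t[of i j] t[of i "j + 1"] t[of "i + 1" j] t[of "i + 1" "j + 1"]
      by (simp_all add: add.assoc)
    have "det ?A * M (i + 1) (j + 1) =
        (M i j * M (i + 1) (j + 1) - M i (j + 1) * M (i + 1) j)
        * (M (i + 1) (j + 1) * M (i + 2) (j + 2) - M (i + 1) (j + 2) * M (i + 2) (j + 1))
      - (M i (j + 1) * M (i + 1) (j + 2) - M i (j + 2) * M (i + 1) (j + 1))
        * (M (i + 1) j * M (i + 2) (j + 1) - M (i + 1) (j + 1) * M (i + 2) j)"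
      unfolding D by algebra
    also have "\<dots> = 0" unfolding t1 t2 t3 t4 by simp
    finally show ?thesis using nz by simp
  qed
qed

lemma FR_infty_pos_subset: "FR_infty_pos \<subseteq> FR_infty"
  using positive_infinite_frieze_tame
  by (auto simp: FR_infty_pos_def FR_infty_def positive_infinite_frieze_def)

section \<open>The Farey graph and its bi-infinite paths\<close>

datatype rat_infty = Fin rat | Infty

definition reduced_rational :: "rat_infty \<Rightarrow> int \<Rightarrow> int \<Rightarrow> bool" where
  "reduced_rational x a b \<longleftrightarrow>
     coprime a b \<and> x = (if b = 0 then Infty else Fin (of_int a / of_int b))"

text \<open>The reduced rational representing a vertex is unique up to a common sign, which
  does not affect the condition below.\<close>

definition farey_adjacent :: "rat_infty \<Rightarrow> rat_infty \<Rightarrow> bool" where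
  "farey_adjacent x y \<longleftrightarrow>
     (\<exists>a b c d. reduced_rational x a b \<and> reduced_rational y c d \<and>
        (a * d - b * c = 1 \<or> a * d - b * c = - 1))"

type_synonym path = "int \<Rightarrow> rat_infty"

definition bi_infinite_path :: "path \<Rightarrow> bool" where
  "bi_infinite_path v \<longleftrightarrow> (\<forall>i. farey_adjacent (v i) (v (i + 1)))"

fun circle_point :: "rat_infty \<Rightarrow> complex" where
  "circle_point Infty = \<i>"
| "circle_point (Fin z) = (\<i> * of_rat z + 1) / (of_rat z + \<i>)"

text \<open>Starting at \<open>x\<close> and moving clockwise, one meets \<open>y\<close> and then \<open>z\<close> within less than a
  full turn.\<close>

definition clockwise_order :: "complex \<Rightarrow> complex \<Rightarrow> complex \<Rightarrow> bool" where
  "clockwise_order x y z \<longleftrightarrow>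
     (\<exists>\<theta> s t. 0 < s \<and> s < t \<and> t < 2 * pi \<and>
        x = cis \<theta> \<and> y = cis (\<theta> - s) \<and> z = cis (\<theta> - t))"

definition clockwise_paths :: "path set" where
  "clockwise_paths = {v. bi_infinite_path v \<and> inj v \<and>
     (\<forall>i j k. i < j \<and> j < k \<longrightarrow>
        clockwise_order (circle_point (v i)) (circle_point (v j)) (circle_point (v k)))}"

section \<open>The action of \<open>SL\<^sub>2(\<int>)\<close>\<close>

definition SL2Z :: "(int^2^2) set" where
  "SL2Z = {A. det A = 1}"

fun moebius :: "int^2^2 \<Rightarrow> rat_infty \<Rightarrow> rat_infty" where
  "moebius A Infty =
     (if A $ 2 $ 1 = 0 then Infty else Fin (of_int (A $ 1 $ 1) / of_int (A $ 2 $ 1)))"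
| "moebius A (Fin z) =
     (if of_int (A $ 2 $ 1) * z + of_int (A $ 2 $ 2) = 0 then Infty
      else Fin ((of_int (A $ 1 $ 1) * z + of_int (A $ 1 $ 2)) /
                (of_int (A $ 2 $ 1) * z + of_int (A $ 2 $ 2))))"

definition SL2Z_orbit_rel :: "(path \<times> path) set" where
  "SL2Z_orbit_rel = {(v, w). \<exists>A\<in>SL2Z. w = moebius A \<circ> v}"

section \<open>The map \<open>\<Phi>\<close>\<close>

definition normalised :: "path \<Rightarrow> (int \<Rightarrow> int) \<Rightarrow> (int \<Rightarrow> int) \<Rightarrow> bool" where
  "normalised v a b \<longleftrightarrow>
     (\<forall>i. reduced_rational (v i) (a i) (b i)) \<and>
     (\<forall>i. a i * b (i + 1) - a (i + 1) * b i = 1)"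

definition path_tiling :: "(int \<Rightarrow> int) \<Rightarrow> (int \<Rightarrow> int) \<Rightarrow> tiling" where
  "path_tiling a b = (\<lambda>i j. a j * b i - b j * a i)"

text \<open>As usual for functions on a quotient, \<open>\<Phi>\<close> is the union of the values on all
  representatives. These values are two-element sets \<open>pm M\<close>, so \<open>Phi C\<close> has the form \<open>pm M\<close>
  precisely if a representative and a normalisation exist and all choices give the same
  \<open>pm M\<close>.\<close>

definition Phi :: "path set \<Rightarrow> tiling set" where
  "Phi C = (\<Union>v\<in>C. \<Union>{pm (path_tiling a b) | a b. normalised v a b})"

end

theory Submission imports Defs
begin

text \<open>Write \<open>D i j = a\<^sub>i b\<^sub>j - a\<^sub>j b\<^sub>i\<close> for a normalised path. On the circle the
  vertex \<open>a/b\<close> has angle \<open>pi/2 - 2 \<phi>\<close>, where \<open>\<phi>\<close> is the angle of the vector \<open>(a, b)\<close>, so three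
  vertices are in clockwise order iff \<open>D i j * D j k * D i k > 0\<close>. Since \<open>D i (i + 1) = 1\<close>,
  a path is clockwise iff \<open>D i j > 0\<close> for all \<open>i < j\<close>, that is, iff its tiling is positive.
  Conversely, a positive frieze satisfies a three-term recurrence along its rows, so it has
  rank 2 and is determined by its columns 0 and 1, which provide a path. Two paths with the same
  tiling differ by the matrix that matches their vertices 0 and 1.\<close>

section \<open>Clockwise order and determinants\<close>

text \<open>Clearing the denominator \<open>b\<close> turns \<open>\<i> z + 1\<close> and
  \<open>z + \<i>\<close> into \<open>\<i>\<close> times the conjugate of the complex number
  \<open>(a, b)\<close> and that number itself. The resulting formula is homogeneous in
  \<open>(a, b)\<close>, so it covers the vertex \<open>Infty\<close> as well.\<close>

lemma circle_point_reduced: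
  assumes "reduced_rational x a b"
  shows "circle_point x = \<i> * cnj (Complex (of_int a) (of_int b)) / Complex (of_int a) (of_int b)"
proof (cases "b = 0")
  case True
  with assms have "a \<noteq> 0" "x = Infty" by (auto simp: reduced_rational_def)
  moreover have "Complex (of_int a) 0 = of_int a" by (simp add: complex_eq_iff)
  ultimately show ?thesis using True by simp
next
  case False
  then have x: "x = Fin (of_int a / of_int b)" using assms by (simp add: reduced_rational_def)
  have b: "(of_int b :: complex) \<noteq> 0" using False by simp
  have "circle_point x =
      (\<i> * (of_int a / of_int b) + 1) / (of_int a / of_int b + \<i>)"
    by (simp add: x of_rat_divide)
  also have "\<dots> = ((\<i> * (of_int a / of_int b) + 1) * of_int b) / ((of_int a / of_int b + \<i>) * of_int b)"
    using b by simp
  also have "(\<i> * (of_int a / of_int b) + 1) * of_int b = \<i> * cnj (Complex (of_int a) (of_int b))"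
    using b by (simp add: algebra_simps complex_eq_iff)
  also have "(of_int a / of_int b + \<i>) * of_int b = Complex (of_int a) (of_int b)"
    using b by (simp add: algebra_simps complex_eq_iff)
  finally show ?thesis .
qed

text \<open>Dividing the conjugate by \<open>w\<close> removes the modulus and doubles the angle.
  The factor \<open>r\<close> may be negative: a vertex determines its integer vector only up to
  sign, hence the angle only modulo pi.\<close>

lemma polar_doubled_angle:
  assumes "w = of_real r * cis \<phi>" "r \<noteq> 0"
  shows "\<i> * cnj w / w = cis (pi / 2 - 2 * \<phi>)"
proof -
  have "cnj w / w = cis (- \<phi>) / cis \<phi>" using assms by (simp add: cis_cnj)
  also have "\<dots> = cis (- 2 * \<phi>)" by (simp add: cis_divide)
  finally show ?thesis
    by (simp add: cis_mult flip: cis_pi_half times_divide_eq_right)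
qed

lemma polar_of_doubled_angle:
  assumes "w \<noteq> 0" "\<i> * cnj w / w = cis (pi / 2 - 2 * \<phi>)"
  obtains r where "r \<noteq> 0" "w = of_real r * cis \<phi>"
proof -
  have "\<i> * (cnj w / w) = \<i> * cis (- 2 * \<phi>)"
    using assms(2) by (simp add: cis_mult flip: cis_pi_half)
  then have "cnj w = cis (- 2 * \<phi>) * w" using assms(1) by (simp add: field_simps)
  \<comment> \<open>Rotating \<open>w\<close> back by \<phi> gives a number equal to its own
    conjugate; this real number is the required \<open>r\<close>.\<close>
  then have "cnj (w * cis (- \<phi>)) = cis \<phi> * (cis (- 2 * \<phi>) * w)" by (simp add: cis_cnj)
  also have "\<dots> = w * cis (- \<phi>)" by (simp add: cis_mult flip: mult.assoc)
  finally have "w * cis (- \<phi>) \<in> \<real>" by (simp add: Reals_cnj_iff)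
  then obtain r where r: "w * cis (- \<phi>) = of_real r" by (auto elim: Reals_cases)
  have "w = w * cis (- \<phi>) * cis \<phi>" by (simp add: cis_mult mult.assoc)
  then have "w = of_real r * cis \<phi>" by (simp add: r)
  with assms(1) show ?thesis by (intro that[of r]) auto
qed

text \<open>Since \<open>r\<close> may be negative, the direction can be moved by pi into the half
  turn starting at \<phi>. This is done when the argument of the rotated vector is negative or equal
  to pi.\<close>

lemma polar_half_turn:
  assumes "w \<noteq> 0"
  obtains r s where "r \<noteq> 0" "0 \<le> s" "s < pi" "w = of_real r * cis (\<phi> + s)"
proof -
  define z where "z = w * cis (- \<phi>)"
  have w: "w = z * cis \<phi>" by (simp add: z_def cis_mult mult.assoc)
  have "z \<noteq> 0" using assms by (simp add: z_def)
  define n where "n = norm z"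
  have n: "n \<noteq> 0" "z = of_real n * cis (Arg z)"
    using \<open>z \<noteq> 0\<close> rcis_cmod_Arg[of z] by (auto simp: n_def rcis_def)
  have w': "w = of_real n * cis (\<phi> + Arg z)"
    using n(2) w by (metis cis_mult mult.assoc add.commute)
  consider "0 \<le> Arg z" "Arg z < pi" | "Arg z < 0" | "Arg z = pi"
    using Arg_bounded[of z] by linarith
  then show ?thesis
  proof cases
    case 1
    then show ?thesis using that w' n(1) by blast
  next
    case 2
    have "w = of_real (- n) * cis (\<phi> + (Arg z + pi))"
      using w' by (simp add: complex_eq_iff cos_add sin_add algebra_simps)
    then show ?thesis using that[of "- n" "Arg z + pi"] 2 Arg_bounded[of z] n(1) by simp
  next
    case 3
    have "w = of_real (- n) * cis (\<phi> + 0)"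
      using w' 3 by (simp add: complex_eq_iff)
    then show ?thesis using that[of "- n" 0] n(1) pi_gt_zero by simp
  qed
qed

lemma det_polar:
  assumes "Complex a b = of_real r * cis \<phi>" "Complex c d = of_real q * cis \<psi>"
  shows "a * d - c * b = r * q * sin (\<psi> - \<phi>)"
proof -
  have "a = r * cos \<phi>" "b = r * sin \<phi>" "c = q * cos \<psi>" "d = q * sin \<psi>"
    using assms by (simp_all add: complex_eq_iff)
  then show ?thesis by (simp add: sin_diff algebra_simps)
qed

text \<open>Each vector enters exactly two of the three determinants, so the product does not see
  the choice of signs. In polar form it is a positive square times
  \<open>sin s * sin (t - s) * sin t\<close>, where \<open>s\<close> and \<open>t\<close> are half
  the clockwise angles from the first point to the other two.\<close>

lemma clockwise_order_iff:
  assumes x: "reduced_rational x a b" and y: "reduced_rational y c d" and z: "reduced_rational z e f"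
  shows "clockwise_order (circle_point x) (circle_point y) (circle_point z) \<longleftrightarrow>
    (a * d - c * b) * (c * f - e * d) * (a * f - e * b) > 0"
proof -
  define u where "u = Complex (of_int a) (of_int b)"
  define v where "v = Complex (of_int c) (of_int d)"
  define w where "w = Complex (of_int e) (of_int f)"
  have nz: "u \<noteq> 0" "v \<noteq> 0" "w \<noteq> 0"
    using x y z by (auto simp: u_def v_def w_def complex_eq_iff reduced_rational_def)
  have cp: "circle_point x = \<i> * cnj u / u" "circle_point y = \<i> * cnj v / v"
    "circle_point z = \<i> * cnj w / w"
    using x y z by (simp_all add: circle_point_reduced u_def v_def w_def)
  let ?P = "(a * d - c * b) * (c * f - e * d) * (a * f - e * b)"
  have P: "real_of_int ?P = (r * q * p)\<^sup>2 * (sin s * sin (t - s) * sin t)"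
    if "u = of_real r * cis \<phi>" "v = of_real q * cis (\<phi> + s)" "w = of_real p * cis (\<phi> + t)"
    for r q p \<phi> s t
  proof -
    have "real_of_int a * of_int d - of_int c * of_int b = r * q * sin s"
      using det_polar[OF that(1,2)[unfolded u_def v_def]] by simp
    moreover have "real_of_int c * of_int f - of_int e * of_int d = q * p * sin (t - s)"
      using det_polar[OF that(2,3)[unfolded w_def v_def]] by (simp add: algebra_simps)
    moreover have "real_of_int a * of_int f - of_int e * of_int b = r * p * sin t"
      using det_polar[OF that(1,3)[unfolded u_def w_def]] by simp
    ultimately show ?thesis by (simp add: power2_eq_square)
  qed
  show ?thesis
  proof
    assume "clockwise_order (circle_point x) (circle_point y) (circle_point z)"
    then obtain \<theta> s t where st: "0 < s" "s < t" "t < 2 * pi" and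
      c: "circle_point x = cis \<theta>" "circle_point y = cis (\<theta> - s)" "circle_point z = cis (\<theta> - t)"
      by (auto simp: clockwise_order_def)
    \<comment> \<open>This solves \<open>\<theta> = pi / 2 - 2 * \<phi>\<close>; clockwise rotation
      by \<open>s\<close> on the circle raises the vector angle by \<open>s / 2\<close>.\<close>
    define \<phi> where "\<phi> = (pi / 2 - \<theta>) / 2"
    have "\<i> * cnj u / u = cis (pi / 2 - 2 * \<phi>)"
      "\<i> * cnj v / v = cis (pi / 2 - 2 * (\<phi> + s / 2))"
      "\<i> * cnj w / w = cis (pi / 2 - 2 * (\<phi> + t / 2))"
      using c by (simp_all add: cp \<phi>_def algebra_simps add_divide_distrib diff_divide_distrib)
    then obtain r q p where r: "r \<noteq> 0" "q \<noteq> 0" "p \<noteq> 0"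
      "u = of_real r * cis \<phi>" "v = of_real q * cis (\<phi> + s / 2)" "w = of_real p * cis (\<phi> + t / 2)"
      using nz by (metis polar_of_doubled_angle)
    have "sin (s / 2) > 0" "sin (t / 2 - s / 2) > 0" "sin (t / 2) > 0"
      using st by (auto intro!: sin_gt_zero)
    moreover have "(r * q * p)\<^sup>2 > 0" using r by simp
    ultimately have "real_of_int ?P > 0" unfolding P[OF r(4-6)] by (intro mult_pos_pos)
    then show "?P > 0" by linarith
  next
    assume pos: "?P > 0"
    obtain r \<phi> where r: "r \<noteq> 0" "u = of_real r * cis \<phi>"
      using polar_half_turn[OF nz(1)] by blast
    \<comment> \<open>Both angles are measured from the direction of \<open>u\<close> and taken in
      \<open>[0, pi)\<close>, so that after doubling they stay below a full turn.\<close>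
    obtain q s where q: "q \<noteq> 0" "0 \<le> s" "s < pi" "v = of_real q * cis (\<phi> + s)"
      using polar_half_turn[OF nz(2)] by blast
    obtain p t where p: "p \<noteq> 0" "0 \<le> t" "t < pi" "w = of_real p * cis (\<phi> + t)"
      using polar_half_turn[OF nz(3)] by blast
    have "real_of_int ?P > 0" using pos by linarith
    then have S: "sin s * sin (t - s) * sin t > 0"
      unfolding P[OF r(2) q(4) p(4)] by (simp add: zero_less_mult_iff)
    \<comment> \<open>On \<open>[0, pi)\<close> a nonzero sine is positive, so the sign of the
      product is that of \<open>sin (t - s)\<close>, which decides whether
      \<open>s < t\<close>.\<close>
    then have "sin s \<noteq> 0" "sin t \<noteq> 0" by auto
    with q p have "sin s > 0" "sin t > 0"
      by (metis order_less_le sin_gt_zero sin_zero)+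
    with S have S': "sin (t - s) > 0"
      by (simp add: zero_less_mult_iff)
    have "t > s"
    proof (rule ccontr)
      assume "\<not> t > s"
      then have "sin (s - t) \<ge> 0" using q p by (intro sin_ge_zero) auto
      with S' show False using sin_minus[of "t - s"] by simp
    qed
    moreover have "s > 0" using \<open>sin s \<noteq> 0\<close> q(2) by (cases "s = 0") auto
    moreover have "circle_point x = cis (pi / 2 - 2 * \<phi>)"
      "circle_point y = cis (pi / 2 - 2 * \<phi> - 2 * s)" "circle_point z = cis (pi / 2 - 2 * \<phi> - 2 * t)"
      using polar_doubled_angle[OF r(2,1)] polar_doubled_angle[OF q(4,1)]
        polar_doubled_angle[OF p(4,1)] by (simp_all add: cp algebra_simps)
    ultimately show "clockwise_order (circle_point x) (circle_point y) (circle_point z)"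
      using p(3) unfolding clockwise_order_def
      by (intro exI[of _ "pi / 2 - 2 * \<phi>"] exI[of _ "2 * s"] exI[of _ "2 * t"]) auto
  qed
qed

section \<open>Normalised paths\<close>

lemma reduced_rational_exists: "\<exists>a b. reduced_rational x a b"
proof (cases x)
  case (Fin r)
  obtain a b where "quotient_of r = (a, b)" by (cases "quotient_of r")
  then have "coprime a b" "b > 0" "r = of_int a / of_int b"
    by (auto simp: quotient_of_coprime quotient_of_denom_pos quotient_of_div)
  with Fin have "reduced_rational x a b" by (simp add: reduced_rational_def)
  then show ?thesis by blast
next
  case Infty
  then have "reduced_rational x 1 0" by (simp add: reduced_rational_def)
  then show ?thesis by blast
qed

lemma reduced_rational_cross:
  assumes "reduced_rational x a b" "reduced_rational x c d"
  shows "a * d = c * b"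
proof (cases "b = 0")
  case True
  with assms show ?thesis by (auto simp: reduced_rational_def split: if_splits)
next
  case False
  with assms have d: "d \<noteq> 0" "(of_int a / of_int b :: rat) = of_int c / of_int d"
    by (auto simp: reduced_rational_def split: if_splits)
  with False have "(of_int (a * d) :: rat) = of_int (c * b)" by (simp add: frac_eq_eq)
  then show ?thesis by (simp only: of_int_eq_iff)
qed

lemma reduced_rational_unique:
  assumes "reduced_rational x a b" "reduced_rational x c d"
  obtains e :: int where "e = 1 \<or> e = - 1" "c = e * a" "d = e * b"
proof -
  have cr: "a * d = c * b" using reduced_rational_cross[OF assms] .
  have co: "coprime a b" "coprime c d" using assms by (auto simp: reduced_rational_def)
  from bezout_int[of a b] obtain p q where pq: "p * a + q * b = 1"
    using co by auto
  \<comment> \<open>With the Bezout identity \<open>p * a + q * b = 1\<close>, the relation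
    \<open>a * d = c * b\<close> gives \<open>e * a = c\<close> and \<open>e * b = d\<close>. As a
    common divisor of the coprime \<open>c\<close> and \<open>d\<close>, the number \<open>e\<close>
    is a unit.\<close>
  define e where "e = p * c + q * d"
  have c: "c = e * a" and d: "d = e * b"
    using cr pq unfolding e_def by algebra+
  have "e dvd c" "e dvd d" using c d by simp_all
  then have "is_unit e" using co(2) coprime_common_divisor by blast
  then have "e = 1 \<or> e = - 1" by auto
  with c d show ?thesis using that by blast
qed

lemma reduced_rational_sign:
  assumes "reduced_rational x a b" "s = 1 \<or> s = - 1"
  shows "reduced_rational x (s * a) (s * b)"
  using assms by (auto simp: reduced_rational_def)

lemma farey_adjacent_det:
  assumes "farey_adjacent x y" "reduced_rational x a b" "reduced_rational y c d"
  shows "a * d - c * b = 1 \<or> a * d - c * b = - 1"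
proof -
  obtain a' b' c' d' where
    r: "reduced_rational x a' b'" "reduced_rational y c' d'" and
    D: "a' * d' - b' * c' = 1 \<or> a' * d' - b' * c' = - 1"
    using assms(1) by (auto simp: farey_adjacent_def)
  obtain e where "e = 1 \<or> e = - 1" "a = e * a'" "b = e * b'"
    using reduced_rational_unique[OF r(1) assms(2)] by blast
  moreover obtain e' where "e' = 1 \<or> e' = - 1" "c = e' * c'" "d = e' * d'"
    using reduced_rational_unique[OF r(2) assms(3)] by blast
  ultimately show ?thesis using D by (auto simp: algebra_simps)
qed

text \<open>Arbitrary reduced representatives have consecutive determinants \<open>D i\<close> equal
  to 1 or -1. Rescaling by signs with \<open>s i * s (i + 1) = D i\<close> makes all of them
  1.\<close>

lemma bi_infinite_path_normalised:
  assumes "bi_infinite_path v"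
  shows "\<exists>a b. normalised v a b"
proof -
  have "\<forall>i. \<exists>p q. reduced_rational (v i) p q" using reduced_rational_exists by blast
  then obtain p q where pq: "\<And>i. reduced_rational (v i) (p i) (q i)" by metis
  define D where "D i = p i * q (i + 1) - p (i + 1) * q i" for i
  \<comment> \<open>The signs are accumulated outwards from index 0 in both directions; the empty
    product gives \<open>s 0 = 1\<close>.\<close>
  define s where "s i = (if i \<ge> 0 then \<Prod>k\<in>{0..<i}. D k else \<Prod>k\<in>{i..<0}. D k)" for i
  have D: "D i = 1 \<or> D i = - 1" for i
    unfolding D_def using assms farey_adjacent_det[OF _ pq pq] by (simp add: bi_infinite_path_def)
  have prod: "(\<Prod>k\<in>A. D k) = 1 \<or> (\<Prod>k\<in>A. D k) = - 1" for A
    by (induction A rule: infinite_finite_induct) (use D in force)+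
  have s: "s i = 1 \<or> s i = - 1" for i
    unfolding s_def using prod by simp
  have ss: "s i * s (i + 1) = D i" for i
  proof (cases "i \<ge> 0")
    case True
    then have "{0..<i + 1} = insert i {0..<i}" by auto
    with True have "s (i + 1) = D i * s i" by (simp add: s_def)
    then show ?thesis using s[of i] by auto
  next
    case False
    then have "{i..<0} = insert i {i + 1..<0}" by auto
    with False have "s i = D i * s (i + 1)" by (auto simp: s_def)
    then show ?thesis using s[of "i + 1"] by auto
  qed
  have "s i * p i * (s (i + 1) * q (i + 1)) - s (i + 1) * p (i + 1) * (s i * q i)
      = s i * s (i + 1) * D i" for i
    unfolding D_def by algebra
  moreover have "D i * D i = 1" for i using D[of i] by auto
  ultimately have "normalised v (\<lambda>i. s i * p i) (\<lambda>i. s i * q i)"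
    using pq s ss by (simp add: normalised_def reduced_rational_sign)
  then show ?thesis by blast
qed

section \<open>Clockwise paths and positive tilings\<close>

lemma path_tiling_frieze:
  assumes "normalised v a b"
  shows "infinite_frieze (path_tiling a b)"
proof -
  have n: "a i * b (i + 1) - a (i + 1) * b i = 1" for i
    using assms by (simp add: normalised_def)
  \<comment> \<open>The tiling matrix is a product of a matrix with two columns and one with two
    rows, so its 2 by 2 minors factor into two consecutive determinants.\<close>
  have "path_tiling a b i j * path_tiling a b (i + 1) (j + 1)
      - path_tiling a b i (j + 1) * path_tiling a b (i + 1) j
    = (a i * b (i + 1) - a (i + 1) * b i) * (a j * b (j + 1) - a (j + 1) * b j)" for i j
    unfolding path_tiling_def by algebra
  then have "sl2_tiling (path_tiling a b)" by (simp add: sl2_tiling_def n)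
  then show ?thesis by (simp add: infinite_frieze_def path_tiling_def)
qed

text \<open>Induction on \<open>i\<close> with \<open>j\<close> fixed: in the triple
  \<open>j\<close>, \<open>i\<close>, \<open>i + 1\<close> the first determinant is positive by
  induction and the second is 1, so clockwise order forces the third to be positive.\<close>

lemma clockwise_path_tiling_positive:
  assumes "v \<in> clockwise_paths" "normalised v a b"
  shows "positive_infinite_frieze (path_tiling a b)"
proof -
  have r: "reduced_rational (v i) (a i) (b i)" and D: "a i * b (i + 1) - a (i + 1) * b i = 1" for i
    using assms(2) by (auto simp: normalised_def)
  have triple: "(a i * b j - a j * b i) * (a j * b k - a k * b j) * (a i * b k - a k * b i) > 0"
    if "i < j" "j < k" for i j k
    using assms(1) that clockwise_order_iff[OF r r r] by (simp add: clockwise_paths_def)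
  have "a j * b i - a i * b j > 0" if "j < i" for i j
    using that
  proof (induction i rule: int_gr_induct)
    case base
    show ?case using D[of j] by simp
  next
    case (step i)
    then show ?case using D[of i] triple[of j i "i + 1"]
      by (simp add: zero_less_mult_iff)
  qed
  then show ?thesis
    using path_tiling_frieze[OF assms(2)]
    by (simp add: positive_infinite_frieze_def path_tiling_def mult.commute)
qed

text \<open>All three determinants in the clockwise criterion are positive, and a repeated vertex
  would make a determinant vanish.\<close>

lemma positive_tiling_clockwise:
  assumes "normalised v a b" "positive_infinite_frieze (path_tiling a b)"
  shows "v \<in> clockwise_paths"
proof -
  have r: "reduced_rational (v i) (a i) (b i)" and D: "a i * b (i + 1) - a (i + 1) * b i = 1" for i
    using assms(1) by (auto simp: normalised_def)
  have pos: "a i * b j - a j * b i > 0" if "i < j" for i j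
    using assms(2) that by (simp add: positive_infinite_frieze_def path_tiling_def mult.commute)
  have "farey_adjacent (v i) (v (i + 1))" for i
    unfolding farey_adjacent_def
    by (rule exI[of _ "a i"], rule exI[of _ "b i"], rule exI[of _ "a (i + 1)"],
        rule exI[of _ "b (i + 1)"]) (use r D[of i] in \<open>simp add: mult.commute\<close>)
  then have "bi_infinite_path v" by (simp add: bi_infinite_path_def)
  moreover have "v i \<noteq> v j" if "i < j" for i j
  proof
    assume "v i = v j"
    then have "a i * b j = a j * b i" using reduced_rational_cross r by metis
    with pos[OF that] show False by simp
  qed
  then have "inj v" by (metis injI linorder_neqE)
  moreover have "clockwise_order (circle_point (v i)) (circle_point (v j)) (circle_point (v k))"
    if "i < j" "j < k" for i j k
    unfolding clockwise_order_iff[OF r r r]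
    using pos[OF that(1)] pos[OF that(2)] pos[of i k] that by simp
  ultimately show ?thesis by (simp add: clockwise_paths_def)
qed

text \<open>No global sign has to be found: vertex by vertex the two normalisations agree up to
  sign, hence so do the tiling entries, and positivity below the diagonal settles the sign.\<close>

lemma clockwise_path_tiling_unique:
  assumes "v \<in> clockwise_paths" "normalised v a b" "normalised v c d"
  shows "path_tiling c d = path_tiling a b"
proof (intro ext)
  fix i j
  have r: "reduced_rational (v i) (a i) (b i)" "reduced_rational (v i) (c i) (d i)" for i
    using assms(2,3) by (auto simp: normalised_def)
  have P: "positive_infinite_frieze (path_tiling a b)" "positive_infinite_frieze (path_tiling c d)"
    using assms clockwise_path_tiling_positive by auto
  have eq: "path_tiling c d i j = path_tiling a b i j" if "j < i" for i j
  proof -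
    obtain e where "e = 1 \<or> e = - 1" "c i = e * a i" "d i = e * b i"
      using reduced_rational_unique[OF r] by blast
    moreover obtain e' where "e' = 1 \<or> e' = - 1" "c j = e' * a j" "d j = e' * b j"
      using reduced_rational_unique[OF r] by blast
    ultimately have "path_tiling c d i j = path_tiling a b i j \<or>
        path_tiling c d i j = - path_tiling a b i j"
      by (auto simp: path_tiling_def)
    moreover have "path_tiling c d i j > 0" "path_tiling a b i j > 0"
      using P that by (auto simp: positive_infinite_frieze_def)
    ultimately show ?thesis by linarith
  qed
  have skew: "path_tiling f g i j = - path_tiling f g j i" for f g
    by (simp add: path_tiling_def)
  show "path_tiling c d i j = path_tiling a b i j"
    using eq[of i j] eq[of j i] skew[of c d] skew[of a b]
    by (cases i j rule: linorder_cases) (auto simp: path_tiling_def)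
qed

section \<open>The action of the modular group\<close>

lemma SL2Z_iff: "A \<in> SL2Z \<longleftrightarrow> A $ 1 $ 1 * A $ 2 $ 2 - A $ 1 $ 2 * A $ 2 $ 1 = 1"
  by (simp add: SL2Z_def det_2)

lemma reduced_rational_moebius:
  assumes "A \<in> SL2Z" "reduced_rational x a b"
  shows "reduced_rational (moebius A x)
    (A $ 1 $ 1 * a + A $ 1 $ 2 * b) (A $ 2 $ 1 * a + A $ 2 $ 2 * b)"
proof -
  define p q r s where "p = A $ 1 $ 1" "q = A $ 1 $ 2" "r = A $ 2 $ 1" "s = A $ 2 $ 2"
  note pqrs = this
  have det: "p * s - q * r = 1" using assms(1) by (simp add: SL2Z_iff pqrs)
  have co: "coprime a b" using assms(2) by (simp add: reduced_rational_def)
  have "coprime (p * a + q * b) (r * a + s * b)"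
  proof (rule coprimeI)
    fix k assume k: "k dvd p * a + q * b" "k dvd r * a + s * b"
    \<comment> \<open>The inverse matrix recovers \<open>a\<close> and \<open>b\<close> as integer
      combinations of the image coordinates, so a common divisor of the latter divides both.\<close>
    have "a = (p * s - q * r) * a" "b = (p * s - q * r) * b" using det by simp_all
    then have "a = s * (p * a + q * b) - q * (r * a + s * b)"
      "b = p * (r * a + s * b) - r * (p * a + q * b)" by algebra+
    then have "k dvd a" "k dvd b" using k by (metis dvd_diff dvd_mult)+
    then show "is_unit k" using co coprime_common_divisor by blast
  qed
  moreover have "moebius A x =
    (if r * a + s * b = 0 then Infty else Fin (of_int (p * a + q * b) / of_int (r * a + s * b)))"
  proof (cases "b = 0")
    case True
    then have "a = 1 \<or> a = - 1" "x = Infty" using assms(2) by (auto simp: reduced_rational_def)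
    with True show ?thesis by (auto simp flip: pqrs)
  next
    case False
    then have x: "x = Fin (of_int a / of_int b)" using assms(2) by (simp add: reduced_rational_def)
    have b: "(of_int b :: rat) \<noteq> 0" using False by simp
    have n: "of_int p * (of_int a / of_int b) + of_int q = (of_int (p * a + q * b) / of_int b :: rat)"
      "of_int r * (of_int a / of_int b) + of_int s = (of_int (r * a + s * b) / of_int b :: rat)"
      using b by (simp_all add: add_divide_distrib)
    show ?thesis
      unfolding x moebius.simps pqrs[symmetric] n using b
      by (simp del: of_int_add of_int_mult)
  qed
  ultimately show ?thesis by (simp add: reduced_rational_def pqrs)
qed

lemma reduced_rational_inject:
  "reduced_rational x a b \<Longrightarrow> reduced_rational y a b \<Longrightarrow> x = y"
  by (simp add: reduced_rational_def)

text \<open>On integer vectors the action is matrix multiplication, so both sides are represented by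
  the same reduced vector.\<close>

lemma moebius_mult:
  assumes "A \<in> SL2Z" "B \<in> SL2Z"
  shows "moebius A (moebius B x) = moebius (A ** B) x"
proof -
  obtain a b where r: "reduced_rational x a b" using reduced_rational_exists by blast
  have "A ** B \<in> SL2Z" using assms by (simp add: SL2Z_def det_mul)
  from reduced_rational_moebius[OF this r]
    reduced_rational_moebius[OF assms(1) reduced_rational_moebius[OF assms(2) r]]
  show ?thesis
    by (intro reduced_rational_inject)
      (auto simp: matrix_matrix_mult_def sum_2 algebra_simps)
qed

lemma moebius_one: "moebius (mat 1) x = x"
  by (cases x) (auto simp: mat_def)

lemma SL2Z_inverse:
  assumes "A \<in> SL2Z"
  obtains B where "B \<in> SL2Z" "\<And>x. moebius B (moebius A x) = x"
proof -
  define B :: "int^2^2" where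
    "B = vector [vector [A $ 2 $ 2, - A $ 1 $ 2], vector [- A $ 2 $ 1, A $ 1 $ 1]]"
  have B: "B \<in> SL2Z" using assms by (simp add: SL2Z_iff B_def algebra_simps)
  have "B ** A = mat 1"
    using assms by (simp add: SL2Z_iff B_def vec_eq_iff forall_2 matrix_matrix_mult_def sum_2
        mat_def algebra_simps)
  with B assms show ?thesis using that by (simp add: moebius_mult moebius_one)
qed

lemma equiv_SL2Z_orbit_rel: "equiv UNIV SL2Z_orbit_rel"
proof (rule equivI)
  show "refl SL2Z_orbit_rel"
  proof (rule refl_onI)
    fix v :: path
    have "mat 1 \<in> SL2Z" by (simp add: SL2Z_def det_I)
    moreover have "v = moebius (mat 1) \<circ> v" by (simp add: fun_eq_iff moebius_one)
    ultimately show "(v, v) \<in> SL2Z_orbit_rel" by (auto simp: SL2Z_orbit_rel_def)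
  qed
  show "sym SL2Z_orbit_rel"
  proof (rule symI)
    fix v w assume "(v, w) \<in> SL2Z_orbit_rel"
    then obtain A where A: "A \<in> SL2Z" "w = moebius A \<circ> v" by (auto simp: SL2Z_orbit_rel_def)
    obtain B where B: "B \<in> SL2Z" "\<And>x. moebius B (moebius A x) = x"
      using SL2Z_inverse[OF A(1)] by blast
    then have "v = moebius B \<circ> w" by (simp add: A fun_eq_iff)
    with B show "(w, v) \<in> SL2Z_orbit_rel" by (auto simp: SL2Z_orbit_rel_def)
  qed
  show "trans SL2Z_orbit_rel"
  proof (rule transI)
    fix u v w assume "(u, v) \<in> SL2Z_orbit_rel" "(v, w) \<in> SL2Z_orbit_rel"
    then obtain A B where AB: "A \<in> SL2Z" "B \<in> SL2Z" "v = moebius A \<circ> u" "w = moebius B \<circ> v"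
      by (auto simp: SL2Z_orbit_rel_def)
    then have "w = moebius (B ** A) \<circ> u" by (simp add: fun_eq_iff moebius_mult)
    moreover have "B ** A \<in> SL2Z" using AB by (simp add: SL2Z_def det_mul)
    ultimately show "(u, w) \<in> SL2Z_orbit_rel" by (auto simp: SL2Z_orbit_rel_def)
  qed
qed simp

text \<open>Applying \<open>A\<close> to all vectors multiplies every determinant of two of them by
  \<open>det A = 1\<close>.\<close>

lemma normalised_moebius:
  assumes "A \<in> SL2Z" "normalised v a b"
  defines "c \<equiv> \<lambda>i. A $ 1 $ 1 * a i + A $ 1 $ 2 * b i"
    and "d \<equiv> \<lambda>i. A $ 2 $ 1 * a i + A $ 2 $ 2 * b i"
  shows "normalised (moebius A \<circ> v) c d" and "path_tiling c d = path_tiling a b"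
proof -
  have "c j * d i - d j * c i
    = (A $ 1 $ 1 * A $ 2 $ 2 - A $ 1 $ 2 * A $ 2 $ 1) * (a j * b i - b j * a i)" for i j
    unfolding c_def d_def by algebra
  then have D: "c j * d i - d j * c i = a j * b i - b j * a i" for i j
    using assms(1) by (simp add: SL2Z_iff)
  then show "path_tiling c d = path_tiling a b" by (simp add: path_tiling_def)
  have "c i * d (i + 1) - c (i + 1) * d i = 1" for i
    using D[of i "i + 1"] assms(2) by (simp add: normalised_def mult.commute)
  then show "normalised (moebius A \<circ> v) c d"
    using assms(1,2) by (simp add: normalised_def c_def d_def reduced_rational_moebius)
qed

text \<open>This is the well-definedness of \<open>Phi\<close>: a normalisation of any path in the
  orbit is carried back to \<open>v\<close> by a group element without changing its tiling, and
  there all normalisations have the same tiling.\<close>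

lemma Phi_orbit:
  assumes "v \<in> clockwise_paths" "normalised v a b"
  shows "Phi (SL2Z_orbit_rel `` {v}) = pm (path_tiling a b)"
proof -
  have eq: "path_tiling c d = path_tiling a b"
    if "(v, w) \<in> SL2Z_orbit_rel" "normalised w c d" for w c d
  proof -
    have "(w, v) \<in> SL2Z_orbit_rel"
      using that(1) equiv_SL2Z_orbit_rel by (auto simp: equiv_def dest: symD)
    then obtain A where "A \<in> SL2Z" "v = moebius A \<circ> w" by (auto simp: SL2Z_orbit_rel_def)
    with normalised_moebius[OF _ that(2), of A] obtain c' d'
      where "normalised v c' d'" "path_tiling c' d' = path_tiling c d" by blast
    with clockwise_path_tiling_unique[OF assms] show ?thesis by simp
  qed
  have vv: "(v, v) \<in> SL2Z_orbit_rel"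
    using equiv_SL2Z_orbit_rel by (simp add: equiv_class_eq_iff)
  show ?thesis
  proof (intro equalityI subsetI)
    fix N assume "N \<in> Phi (SL2Z_orbit_rel `` {v})"
    then obtain w c d where w: "(v, w) \<in> SL2Z_orbit_rel" "normalised w c d"
      and N: "N \<in> pm (path_tiling c d)"
      unfolding Phi_def by blast
    then show "N \<in> pm (path_tiling a b)" by (simp add: eq[OF w])
  next
    fix N assume "N \<in> pm (path_tiling a b)"
    then show "N \<in> Phi (SL2Z_orbit_rel `` {v})"
      using vv assms(2) unfolding Phi_def by blast
  qed
qed

lemma same_tiling_same_orbit:
  assumes "normalised v a b" "normalised w c d" "path_tiling a b = path_tiling c d"
  shows "(v, w) \<in> SL2Z_orbit_rel"
proof -
  have r: "reduced_rational (v i) (a i) (b i)" "reduced_rational (w i) (c i) (d i)" for i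
    using assms(1,2) by (auto simp: normalised_def)
  have D: "a 0 * b 1 - a 1 * b 0 = 1" "c 0 * d 1 - c 1 * d 0 = 1"
    using assms(1,2) unfolding normalised_def by (metis add_0)+
  have M: "a j * b i - b j * a i = c j * d i - d j * c i" for i j
    using fun_cong[OF fun_cong[OF assms(3)], of i j] by (simp add: path_tiling_def)
  \<comment> \<open>\<open>A\<close> is the matrix with columns \<open>(c 0, d 0)\<close> and
    \<open>(c 1, d 1)\<close> times the inverse of the matrix with columns \<open>(a 0, b 0)\<close>
    and \<open>(a 1, b 1)\<close>.\<close>
  define A :: "int^2^2" where
    "A = vector [vector [c 0 * b 1 - c 1 * b 0, c 1 * a 0 - c 0 * a 1],
                 vector [d 0 * b 1 - d 1 * b 0, d 1 * a 0 - d 0 * a 1]]"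
  have "A $ 1 $ 1 * A $ 2 $ 2 - A $ 1 $ 2 * A $ 2 $ 1
      = (a 0 * b 1 - a 1 * b 0) * (c 0 * d 1 - c 1 * d 0)"
    unfolding A_def vector_2 by algebra
  then have A: "A \<in> SL2Z" by (simp add: SL2Z_iff D)
  \<comment> \<open>By Cramer's rule the coordinates of vector \<open>i\<close> in the basis of
    vectors 0 and 1 are tiling entries. They are the same for both paths, so \<open>A\<close>
    matches all vectors once it matches these two.\<close>
  have "A $ 1 $ 1 * a i + A $ 1 $ 2 * b i
      = c 0 * (a i * b 1 - b i * a 1) + c 1 * (a 0 * b i - b 0 * a i)" for i
    unfolding A_def vector_2 by algebra
  also have "\<dots> i = c i * (c 0 * d 1 - c 1 * d 0)" for i
    unfolding M by algebra
  finally have 1: "A $ 1 $ 1 * a i + A $ 1 $ 2 * b i = c i" for i by (simp add: D)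
  have "A $ 2 $ 1 * a i + A $ 2 $ 2 * b i
      = d 0 * (a i * b 1 - b i * a 1) + d 1 * (a 0 * b i - b 0 * a i)" for i
    unfolding A_def vector_2 by algebra
  also have "\<dots> i = d i * (c 0 * d 1 - c 1 * d 0)" for i
    unfolding M by algebra
  finally have 2: "A $ 2 $ 1 * a i + A $ 2 $ 2 * b i = d i" for i by (simp add: D)
  have "moebius A (v i) = w i" for i
    using reduced_rational_moebius[OF A r(1)[of i]] r(2)[of i]
    unfolding 1 2 by (rule reduced_rational_inject)
  then have "w = moebius A \<circ> v" by (simp add: fun_eq_iff)
  with A show ?thesis by (auto simp: SL2Z_orbit_rel_def)
qed

section \<open>Positive infinite friezes have rank two\<close>

text \<open>The outer terms have coefficient 1, so the recurrence can be run in both directions; the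
  induction carries a pair of consecutive values.\<close>

lemma two_step_recurrence_unique:
  fixes f g k :: "int \<Rightarrow> int"
  assumes f: "\<And>j. f j + f (j + 2) = k j * f (j + 1)"
    and g: "\<And>j. g j + g (j + 2) = k j * g (j + 1)"
    and "f 0 = g 0" "f 1 = g 1"
  shows "f j = g j"
proof -
  have "f j = g j \<and> f (j + 1) = g (j + 1)"
  proof (induction j rule: int_induct[where k = 0])
    case base
    then show ?case using assms(3,4) by simp
  next
    case (step1 j)
    then show ?case using f[of j] g[of j] by (simp add: add.assoc)
  next
    case (step2 j)
    then show ?case using f[of "j - 1"] g[of "j - 1"] by (simp add: add.commute)
  qed
  then show ?thesis ..
qed

context
  fixes M :: tiling
  assumes M: "positive_infinite_frieze M"
begin

lemma frieze_sl2: "M i j * M (i + 1) (j + 1) - M i (j + 1) * M (i + 1) j = 1"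
  using M unfolding positive_infinite_frieze_def infinite_frieze_def sl2_tiling_def by blast

lemma frieze_skew: "M j i = - M i j"
  using M unfolding positive_infinite_frieze_def infinite_frieze_def by blast

lemma frieze_diag: "M i i = 0"
  using frieze_skew[of i i] by linarith

lemma frieze_nonzero: "i \<noteq> j \<Longrightarrow> M i j \<noteq> 0"
  using M frieze_skew[of i j] unfolding positive_infinite_frieze_def
  by (cases i j rule: linorder_cases) fastforce+

lemma frieze_subdiag: "M (i + 1) i = 1"
proof -
  have "M (i + 1) i * M (i + 1) i = 1"
    using frieze_sl2[of i i] frieze_skew[of i "i + 1"] by (simp add: frieze_diag)
  moreover have "M (i + 1) i > 0" using M by (simp add: positive_infinite_frieze_def)
  ultimately show ?thesis by (simp add: zmult_eq_1_iff)
qed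

text \<open>Equating two adjacent 2 by 2 determinants shows that the ratio of
  \<open>M i j + M i (j + 2)\<close> to \<open>M i (j + 1)\<close> is the same in rows
  \<open>i\<close> and \<open>i + 1\<close>, as long as the denominators are nonzero. Its value is
  read off in row \<open>j + 2\<close>. In row \<open>j + 1\<close> the denominator is the zero on
  the diagonal, so that row is checked directly, and separate inductions run upwards from row
  \<open>j + 2\<close> and downwards from row \<open>j\<close>.\<close>

lemma frieze_recurrence: "M i j + M i (j + 2) = M (j + 2) j * M i (j + 1)"
proof -
  have cross: "M (i + 1) (j + 1) * (M i j + M i (j + 2)) = M i (j + 1) * (M (i + 1) j + M (i + 1) (j + 2))"
    for i
  proof -
    have "M i (j + 1) * M (i + 1) (j + 2) - M i (j + 2) * M (i + 1) (j + 1) = 1"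
      using frieze_sl2[of i "j + 1"] by (simp add: add.assoc)
    then show ?thesis using frieze_sl2[of i j] by algebra
  qed
  have sub: "M (j + 1) j = 1" "M (j + 2) (j + 1) = 1"
    using frieze_subdiag[of j] frieze_subdiag[of "j + 1"] by (simp_all add: add.assoc)
  consider "i = j + 1" | "i \<ge> j + 2" | "i \<le> j" by linarith
  then show ?thesis
  proof cases
    case 1
    then show ?thesis
      using sub frieze_skew[of "j + 1" "j + 2"] by (simp add: frieze_diag)
  next
    case 2
    then show ?thesis
    proof (induction i rule: int_ge_induct)
      case base
      show ?case by (simp add: sub frieze_diag)
    next
      case (step i)
      have "M i (j + 1) * (M (i + 1) j + M (i + 1) (j + 2))
          = M i (j + 1) * (M (j + 2) j * M (i + 1) (j + 1))"
        unfolding cross[symmetric] step.IH by simp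
      then show ?case using frieze_nonzero[of i "j + 1"] step.hyps by simp
    qed
  next
    case 3
    then show ?thesis
    proof (induction i rule: int_le_induct)
      case base
      show ?case
        using sub frieze_skew[of j "j + 1"] frieze_skew[of j "j + 2"] by (simp add: frieze_diag)
    next
      case (step i)
      have "M i (j + 1) * (M (i - 1) j + M (i - 1) (j + 2))
          = M i (j + 1) * (M (j + 2) j * M (i - 1) (j + 1))"
        using cross[of "i - 1"] step.IH by (simp add: mult.commute)
      then show ?case using frieze_nonzero[of i "j + 1"] step.hyps by simp
    qed
  qed
qed

text \<open>For fixed \<open>i\<close> both sides satisfy the same recurrence in \<open>j\<close>,
  since the coefficient \<open>M (j + 2) j\<close> does not depend on the row, and they agree at
  \<open>j = 0\<close> and \<open>j = 1\<close>. Skew-symmetry turns the recurrence along rows into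
  one along columns, which the right-hand side needs.\<close>

lemma frieze_rank_two: "M i j = M i 1 * M j 0 - M i 0 * M j 1"
proof (rule two_step_recurrence_unique[where f = "M i" and k = "\<lambda>j. M (j + 2) j"
      and g = "\<lambda>j. M i 1 * M j 0 - M i 0 * M j 1"])
  have rows: "M j i + M (j + 2) i = M (j + 2) j * M (j + 1) i" for i j
    using frieze_recurrence[of i j] frieze_skew[of i j] frieze_skew[of i "j + 1"]
      frieze_skew[of i "j + 2"] by simp
  fix j
  have "M i 1 * M j 0 - M i 0 * M j 1 + (M i 1 * M (j + 2) 0 - M i 0 * M (j + 2) 1)
      = M i 1 * (M j 0 + M (j + 2) 0) - M i 0 * (M j 1 + M (j + 2) 1)" by algebra
  also have "\<dots> = M (j + 2) j * (M i 1 * M (j + 1) 0 - M i 0 * M (j + 1) 1)"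
    unfolding rows by algebra
  finally show "M i 1 * M j 0 - M i 0 * M j 1 + (M i 1 * M (j + 2) 0 - M i 0 * M (j + 2) 1)
      = M (j + 2) j * (M i 1 * M (j + 1) 0 - M i 0 * M (j + 1) 1)" .
qed (use frieze_recurrence frieze_subdiag[of 0] frieze_skew[of 0 1] in \<open>auto simp: frieze_diag\<close>)

lemma frieze_from_path: "\<exists>v a b. normalised v a b \<and> path_tiling a b = M"
proof -
  \<comment> \<open>The minus sign makes the rank two identity read exactly
    \<open>M i j = a j * b i - b j * a i\<close>; coprimality then follows from the consecutive
    determinants being 1.\<close>
  define a b where "a i = - M i 1" and "b i = M i 0" for i
  define v where "v i = (if b i = 0 then Infty else Fin (of_int (a i) / of_int (b i)))" for i
  have T: "a j * b i - b j * a i = M i j" for i j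
    using frieze_rank_two[of i j] by (simp add: a_def b_def algebra_simps)
  have D: "a i * b (i + 1) - a (i + 1) * b i = 1" for i
    using T[of i "i + 1"] frieze_subdiag[of i] by (simp add: mult.commute)
  have "coprime (a i) (b i)" for i
  proof (rule coprimeI)
    fix k assume "k dvd a i" "k dvd b i"
    then have "k dvd a i * b (i + 1) - a (i + 1) * b i" by simp
    then show "is_unit k" by (simp only: D)
  qed
  then have "normalised v a b"
    using D by (simp add: normalised_def reduced_rational_def v_def)
  moreover have "path_tiling a b = M" using T by (simp add: path_tiling_def fun_eq_iff)
  ultimately show ?thesis by blast
qed

end

section \<open>Assembling the bijection\<close>

lemma pm_inject_positive:
  assumes "positive_infinite_frieze M" "positive_infinite_frieze N" "pm M = pm N"
  shows "M = N"
proof -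
  have "M \<in> pm N" using assms(3) by (auto simp: pm_def)
  \<comment> \<open>One entry below the diagonal suffices to tell a positive frieze from the
    negative of another.\<close>
  moreover have "M 1 0 > 0" "N 1 0 > 0" using assms(1,2) by (auto simp: positive_infinite_frieze_def)
  then have "M \<noteq> (\<lambda>i j. - N i j)" by auto
  ultimately show ?thesis by (simp add: pm_def)
qed

theorem theorem1p4:
  "bij_betw Phi (clockwise_paths // SL2Z_orbit_rel) FR_infty_pos"
  unfolding bij_betw_def
proof
  have norm: "\<exists>a b. normalised v a b" if "v \<in> clockwise_paths" for v
    using that bi_infinite_path_normalised by (simp add: clockwise_paths_def)
  show "inj_on Phi (clockwise_paths // SL2Z_orbit_rel)"
  proof (rule inj_onI)
    fix C C' assume "C \<in> clockwise_paths // SL2Z_orbit_rel" "C' \<in> clockwise_paths // SL2Z_orbit_rel"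
    then obtain v w where v: "v \<in> clockwise_paths" "C = SL2Z_orbit_rel `` {v}"
      and w: "w \<in> clockwise_paths" "C' = SL2Z_orbit_rel `` {w}"
      by (auto elim!: quotientE)
    obtain a b c d where n: "normalised v a b" "normalised w c d"
      using norm v(1) w(1) by metis
    assume "Phi C = Phi C'"
    then have "pm (path_tiling a b) = pm (path_tiling c d)"
      using Phi_orbit n v w by simp
    then have "path_tiling a b = path_tiling c d"
      using pm_inject_positive clockwise_path_tiling_positive n v(1) w(1) by blast
    then have "(v, w) \<in> SL2Z_orbit_rel" using same_tiling_same_orbit n by blast
    then show "C = C'" using equiv_class_eq[OF equiv_SL2Z_orbit_rel] v w by simp
  qed
  show "Phi ` (clockwise_paths // SL2Z_orbit_rel) = FR_infty_pos"
  proof (intro equalityI subsetI)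
    fix X assume "X \<in> Phi ` (clockwise_paths // SL2Z_orbit_rel)"
    then obtain v where v: "v \<in> clockwise_paths" "X = Phi (SL2Z_orbit_rel `` {v})"
      by (auto elim!: quotientE)
    obtain a b where n: "normalised v a b" using norm v(1) by blast
    then show "X \<in> FR_infty_pos"
      using v Phi_orbit clockwise_path_tiling_positive by (auto simp: FR_infty_pos_def)
  next
    fix X assume "X \<in> FR_infty_pos"
    then obtain M where M: "positive_infinite_frieze M" "X = pm M" by (auto simp: FR_infty_pos_def)
    obtain v a b where n: "normalised v a b" "path_tiling a b = M"
      using frieze_from_path[OF M(1)] by blast
    then have v: "v \<in> clockwise_paths" using positive_tiling_clockwise M(1) by blast
    then have "X = Phi (SL2Z_orbit_rel `` {v})" using Phi_orbit n M(2) by simp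
    with v show "X \<in> Phi ` (clockwise_paths // SL2Z_orbit_rel)" by (auto intro: quotientI)
  qed
qed

end
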